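(* Let $F_k:\mathbb{R}^n\to\mathcal{I}$ ($k\in K:=\{1,\dots,m\}$) and $g_j:\mathbb{R}^n\to\mathbb{R}$ ($j\in J:=\{1,\dots,p\}$) be locally Lipschitz continuous, $F=(F_1,\dots,F_m)$, $S:=\{u\in\mathbb{R}^n:g_j(u)\le0,\ \forall j\in J\}$. Let $\varepsilon=(\varepsilon_1,\dots,\varepsilon_m)\in\mathbb{R}^m_+\setminus\{0\}$ and let $\overline{u}\in S$ be such that there exist $\lambda\in\mathbb{R}^m_+$ with $\sum_{k\in K}\lambda_k=1$ and $\mu\in\mathbb{R}^p_+$ satisfying $$0\in\sum_{k\in K}\lambda_k\partial^0 F_k(\overline{u})+\sum_{j\in I(\overline{u})}\mu_j\partial^0 g_j(\overline{u})+\sum_{k\in K}\lambda_k\varepsilon_k \mathbb{B}^n,\qquad \mu_jg_j(\overline{u})=0\ \ \forall j\in J.$$ Assume that $(F,g_J)$ is generalized convex at $\overline{u}$ (with respect to $X_0=S$). Then $\overline{u}\in QM(F,S,\varepsilon)$.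
   Context: $\mathcal{I}$ is the set of all compact intervals $[\underline q,\overline q]$ with $\underline q\le\overline q$ real. For $Q=[\underline q,\overline q]\in\mathcal I$ put $q^c=\frac{\underline q+\overline q}{2}$ and $q^w=\frac{\overline q-\underline q}{2}$. Addition: $[\underline q,\overline q]+[\underline r,\overline r]=[\underline q+\underline r,\overline q+\overline r]$. Order: $Q\prec_{CW}R$ iff $q^c<r^c$ and $q^w<r^w$. $\mathbb{R}^m_+$ is the nonnegative orthant; $\mathbb{B}^n$ is the closed unit ball of $\mathbb{R}^n$; $\mathrm{co}$ denotes convex hull. An interval-valued function $f=[\underline f,\overline f]:\mathbb{R}^n\to\mathcal I$ is locally Lipschitz continuous if every point has a neighbourhood $U$ and $L>0$ with $\max\{|\underline f(u_1)-\underline f(u_2)|,|\overline f(u_1)-\overline f(u_2)|\}\le L\|u_1-u_2\|$ for $u_1,u_2\in U$ (equivalently, $\underline f,\overline f$ are locally Lipschitz). Write $f^c=\frac{\underline f+\overline f}{2}$, $f^w=\frac{\overline f-\underline f}{2}$. For locally Lipschitz $\psi:\mathbb{R}^n\to\mathbb{R}$, $\psi^0(z;w)=\limsup_{u\to z,\,t\to0^+}\frac{\psi(u+tw)-\psi(u)}{t}$ and $\partial^0\psi(z)=\{z^*\in\mathbb{R}^n:\langle z^*,w\rangle\le\psi^0(z;w)\ \forall w\}$ (Clarke gradient). For a locally Lipschitz interval-valued $f$, the weakly generalized gradient is $\partial^0f(u):=\mathrm{co}(\partial^0f^c(u)\cup\partial^0f^w(u))$. For $u\in S$, $I(u):=\{j\in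 J:g_j(u)=0\}$; a sum over an empty index set is $\{0\}$. Generalized convexity: for nonempty $X_0\subset\mathbb{R}^n$, $(F,g_J)$ is generalized convex at $u_0\in X_0$ if for any $u\in X_0$, any $u_k^*\in\partial^0F_k(u_0)$ ($k\in K$) and any $z_j^*\in\partial^0g_j(u_0)$ ($j\in J$), there exists $v\in\mathbb{R}^n$ such that $\langle u_k^*,v\rangle\le F_k^c(u)-F_k^c(u_0)+F_k^w(u)-F_k^w(u_0)$ for all $k\in K$, $\langle z_j^*,v\rangle\le g_j(u)-g_j(u_0)$ for all $j\in J$, and $\langle y^*,v\rangle\le\|u-u_0\|$ for all $y^*\in\mathbb{B}^n$. $QM(F,S,\varepsilon)$ (weak $\varepsilon$-quasi-minimal solutions) is the set of $z_0\in S$ for which there is no $z\in S$ with $F_k(z)+[0,\varepsilon_k\|z-z_0\|]\prec_{CW}F_k(z_0)$ for all $k\in K$. *)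

theory Defs
  imports "HOL-Analysis.Analysis" "HOL-Library.Interval"
begin

definition icenter :: "real interval \<Rightarrow> real" where
  "icenter Q = (lower Q + upper Q) / 2"

text \<open>The half-width; the library constant \<open>width\<close> is the full width.\<close>

definition ihalfwidth :: "real interval \<Rightarrow> real" where
  "ihalfwidth Q = (upper Q - lower Q) / 2"

definition prec_CW :: "real interval \<Rightarrow> real interval \<Rightarrow> bool" (infix "\<prec>CW" 50) where
  "Q \<prec>CW R \<longleftrightarrow> icenter Q < icenter R \<and> ihalfwidth Q < ihalfwidth R"

definition locally_lipschitz :: "(real^'n \<Rightarrow> real) \<Rightarrow> bool" where
  "locally_lipschitz \<psi> \<longleftrightarrow>
     (\<forall>u. \<exists>U L. open U \<and> u \<in> U \<and> L > 0 \<and> L-lipschitz_on U \<psi>)"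

definition locally_lipschitz_interval :: "(real^'n \<Rightarrow> real interval) \<Rightarrow> bool" where
  "locally_lipschitz_interval f \<longleftrightarrow>
     (\<forall>u. \<exists>U L. open U \<and> u \<in> U \<and> L > 0 \<and>
        (\<forall>u1\<in>U. \<forall>u2\<in>U.
           max \<bar>lower (f u1) - lower (f u2)\<bar> \<bar>upper (f u1) - upper (f u2)\<bar> \<le> L * norm (u1 - u2)))"

text \<open>The generalized directional derivative takes its value in \<open>ereal\<close>, so that it is meaningful
  as a \<open>Limsup\<close> for every function; it is finite for locally Lipschitz functions. The base point
  \<open>u\<close> tends to \<open>z\<close> along the full neighbourhood filter, \<open>u = z\<close> included.\<close>

definition clarke_deriv :: "(real^'n \<Rightarrow> real) \<Rightarrow> real^'n \<Rightarrow> real^'n \<Rightarrow> ereal" where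
  "clarke_deriv \<psi> z w =
     Limsup (nhds z \<times>\<^sub>F at_right 0) (\<lambda>(u, t). ereal ((\<psi> (u + t *\<^sub>R w) - \<psi> u) / t))"

definition clarke_gradient :: "(real^'n \<Rightarrow> real) \<Rightarrow> real^'n \<Rightarrow> (real^'n) set" where
  "clarke_gradient \<psi> z = {zs. \<forall>w. ereal (zs \<bullet> w) \<le> clarke_deriv \<psi> z w}"

definition weak_gen_gradient :: "(real^'n \<Rightarrow> real interval) \<Rightarrow> real^'n \<Rightarrow> (real^'n) set" where
  "weak_gen_gradient f u =
     convex hull (clarke_gradient (\<lambda>x. icenter (f x)) u \<union> clarke_gradient (\<lambda>x. ihalfwidth (f x)) u)"

text \<open>Families indexed by \<open>{1..m}\<close> and \<open>{1..p}\<close> (objectives, constraints and the vectors of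
  \<open>\<real>\<^sup>m\<close>, \<open>\<real>\<^sup>p\<close>) are functions on \<open>nat\<close>, of which only the values at
  those indices are used.\<close>

definition feasible_set :: "nat \<Rightarrow> (nat \<Rightarrow> real^'n \<Rightarrow> real) \<Rightarrow> (real^'n) set" where
  "feasible_set p g = {u. \<forall>j\<in>{1..p}. g j u \<le> 0}"

definition active_set :: "nat \<Rightarrow> (nat \<Rightarrow> real^'n \<Rightarrow> real) \<Rightarrow> real^'n \<Rightarrow> nat set" where
  "active_set p g u = {j\<in>{1..p}. g j u = 0}"

definition generalized_convex_at ::
  "nat \<Rightarrow> nat \<Rightarrow> (nat \<Rightarrow> real^'n \<Rightarrow> real interval) \<Rightarrow> (nat \<Rightarrow> real^'n \<Rightarrow> real) \<Rightarrow>
   (real^'n) set \<Rightarrow> real^'n \<Rightarrow> bool" where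
  "generalized_convex_at m p F g X0 u0 \<longleftrightarrow>
     u0 \<in> X0 \<and>
     (\<forall>u\<in>X0. \<forall>us zs.
        (\<forall>k\<in>{1..m}. us k \<in> weak_gen_gradient (F k) u0) \<longrightarrow>
        (\<forall>j\<in>{1..p}. zs j \<in> clarke_gradient (g j) u0) \<longrightarrow>
        (\<exists>v.
           (\<forall>k\<in>{1..m}. us k \<bullet> v \<le> icenter (F k u) - icenter (F k u0)
                                  + ihalfwidth (F k u) - ihalfwidth (F k u0)) \<and>
           (\<forall>j\<in>{1..p}. zs j \<bullet> v \<le> g j u - g j u0) \<and>
           (\<forall>ys\<in>cball 0 1. ys \<bullet> v \<le> norm (u - u0))))"

text \<open>\<open>Interval (0, e)\<close> is the interval \<open>[0, e]\<close> only if \<open>0 \<le> e\<close>, so \<open>quasi_min\<close> is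
  meaningful for \<open>\<epsilon>\<close> with nonnegative entries.\<close>

definition quasi_min ::
  "nat \<Rightarrow> (nat \<Rightarrow> real^'n \<Rightarrow> real interval) \<Rightarrow> (real^'n) set \<Rightarrow> (nat \<Rightarrow> real) \<Rightarrow> (real^'n) set" where
  "quasi_min m F S \<epsilon> =
     {z0 \<in> S. \<not> (\<exists>z\<in>S. \<forall>k\<in>{1..m}. F k z + Interval (0, \<epsilon> k * norm (z - z0)) \<prec>CW F k z0)}"

end

theory Submission
  imports Defs
begin

text \<open>Pairing the inclusion in the multiplier rule with the vector \<open>v\<close> supplied by
  generalized convexity gives a nonnegative lower bound for a sum which a point violating
  quasi-minimality would make negative. Generalized convexity only speaks about complete
  selections of Clarke subgradients, including those of the inactive constraints, so it has to be
  known that Clarke gradients are nonempty. This is a Hahn--Banach argument for the strict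
  epigraph of the generalized directional derivative.\<close>

text \<open>The pairs \<open>(w, r)\<close> with \<open>\<psi>\<^sup>0(z; w) < r\<close> are contained in this set. Describing it by
  difference quotients makes it a convex cone without any arithmetic in \<open>ereal\<close>.\<close>

definition clarke_cone :: "(real^'n \<Rightarrow> real) \<Rightarrow> real^'n \<Rightarrow> ((real^'n) \<times> real) set" where
  "clarke_cone \<psi> z =
     {(w, r). eventually (\<lambda>(u, t). \<psi> (u + t *\<^sub>R w) - \<psi> u < r * t) (nhds z \<times>\<^sub>F at_right 0)}"

lemma snd_pos_prod_at_right:
  "eventually (\<lambda>(u, t). 0 < (t::real)) (nhds z \<times>\<^sub>F at_right 0)"
  using eventually_compose_filterlim[OF eventually_at_right_less[of "0::real"] filterlim_snd]
  by (simp add: case_prod_unfold)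

text \<open>Since \<open>u\<close> tends to \<open>z\<close> and \<open>t\<close> to 0, so does
  \<open>u + t *\<^sub>R w\<close> to \<open>z\<close>. Hence whatever holds eventually at the base
  point \<open>u\<close> also holds at the shifted one.\<close>

lemma filterlim_shift_prod_at_right:
  fixes z w :: "'a::real_normed_vector"
  shows "filterlim (\<lambda>(u, t). (u + t *\<^sub>R w, t)) (nhds z \<times>\<^sub>F at_right 0) (nhds z \<times>\<^sub>F at_right 0)"
proof -
  have u: "(fst \<longlongrightarrow> z) (nhds z \<times>\<^sub>F at_right (0::real))"
    by (rule filterlim_fst)
  have s: "filterlim snd (at_right (0::real)) (nhds z \<times>\<^sub>F at_right 0)"
    by (rule filterlim_snd)
  have t: "(snd \<longlongrightarrow> (0::real)) (nhds z \<times>\<^sub>F at_right 0)"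
    by (rule filterlim_mono[OF s]) (auto simp: at_within_le_nhds)
  have "((\<lambda>x. fst x + snd x *\<^sub>R w) \<longlongrightarrow> z + 0 *\<^sub>R w) (nhds z \<times>\<^sub>F at_right (0::real))"
    by (intro tendsto_intros u t)
  then show ?thesis
    unfolding case_prod_unfold by (intro filterlim_Pair s) simp
qed

lemma filterlim_scale_prod_at_right:
  assumes "0 < (s::real)"
  shows "filterlim (\<lambda>(u, t). (u, s * t)) (nhds z \<times>\<^sub>F at_right 0) (nhds z \<times>\<^sub>F at_right 0)"
proof -
  have "filterlim (\<lambda>t. s * t) (at_right 0) (at_right 0)"
    using filterlim_times_pos[of "\<lambda>t. t" 0 "at_right 0" s 0] assms
    by (simp add: filterlim_ident)
  then have "filterlim (\<lambda>x. s * snd x) (at_right 0) (nhds z \<times>\<^sub>F at_right 0)"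
    by (rule filterlim_compose) (rule filterlim_snd)
  then show ?thesis
    unfolding case_prod_unfold by (intro filterlim_Pair filterlim_fst)
qed

text \<open>Telescoping: the increment of \<open>\<psi>\<close> along \<open>w + w'\<close> is the
  increment along \<open>w\<close> from \<open>u\<close> plus the one along \<open>w'\<close> from
  \<open>u + t *\<^sub>R w\<close>. The second is controlled because the base point in Clarke's
  derivative is free to move.\<close>

lemma clarke_cone_add:
  assumes "(w, r) \<in> clarke_cone \<psi> z" "(w', r') \<in> clarke_cone \<psi> z"
  shows "(w + w', r + r') \<in> clarke_cone \<psi> z"
proof -
  have "eventually (\<lambda>(u, t). \<psi> (u + t *\<^sub>R w) - \<psi> u < r * t) (nhds z \<times>\<^sub>F at_right 0)"
    using assms by (simp add: clarke_cone_def)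
  moreover have "eventually (\<lambda>(u, t). \<psi> (u + t *\<^sub>R w + t *\<^sub>R w') - \<psi> (u + t *\<^sub>R w) < r' * t)
      (nhds z \<times>\<^sub>F at_right 0)"
    using assms(2) filterlim_shift_prod_at_right[of w z]
    by (auto simp: clarke_cone_def case_prod_unfold dest: eventually_compose_filterlim)
  ultimately show ?thesis
    unfolding clarke_cone_def mem_Collect_eq prod.case
    by eventually_elim (auto simp: algebra_simps)
qed

text \<open>Positive homogeneity, by substituting \<open>s * t\<close> for the step length
  \<open>t\<close>.\<close>

lemma clarke_cone_scale:
  assumes "(w, r) \<in> clarke_cone \<psi> z" "0 < s"
  shows "(s *\<^sub>R w, s * r) \<in> clarke_cone \<psi> z"
proof -
  have "eventually (\<lambda>(u, t). \<psi> (u + (s * t) *\<^sub>R w) - \<psi> u < r * (s * t)) (nhds z \<times>\<^sub>F at_right 0)"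
    using assms(1) filterlim_scale_prod_at_right[OF assms(2), of z]
    by (auto simp: clarke_cone_def case_prod_unfold dest: eventually_compose_filterlim)
  then show ?thesis
    by (simp add: clarke_cone_def mult.commute mult.left_commute)
qed

lemma convex_clarke_cone: "convex (clarke_cone \<psi> z)"
proof (rule convexI)
  fix x y and a b :: real
  assume xy: "x \<in> clarke_cone \<psi> z" "y \<in> clarke_cone \<psi> z" and ab: "0 \<le> a" "0 \<le> b" "a + b = 1"
  have scale: "c *\<^sub>R q \<in> clarke_cone \<psi> z" if "q \<in> clarke_cone \<psi> z" "0 < c" for q c
    using clarke_cone_scale[of "fst q" "snd q" \<psi> z c] that by (simp add: scaleR_prod_def)
  have add: "q + q' \<in> clarke_cone \<psi> z" if "q \<in> clarke_cone \<psi> z" "q' \<in> clarke_cone \<psi> z" for q q'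
    using clarke_cone_add[of "fst q" "snd q" \<psi> z "fst q'" "snd q'"] that by (simp add: plus_prod_def)
  \<comment> \<open>Zero weights are split off because the cone is closed only under positive
    scaling and omits the origin.\<close>
  consider "a = 0" "b = 1" | "a = 1" "b = 0" | "0 < a" "0 < b"
    using ab by linarith
  then show "a *\<^sub>R x + b *\<^sub>R y \<in> clarke_cone \<psi> z"
    by cases (use xy scale add in auto)
qed

lemma zero_notin_clarke_cone: "0 \<notin> clarke_cone \<psi> z"
proof -
  have "nhds z \<times>\<^sub>F at_right (0::real) \<noteq> bot"
    by (simp add: prod_filter_eq_bot)
  then show ?thesis
    by (simp add: clarke_cone_def zero_prod_def case_prod_unfold)
qed

lemma clarke_cone_zero_direction:
  assumes "0 < r"
  shows "(0, r) \<in> clarke_cone \<psi> z"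
  using snd_pos_prod_at_right[of z] assms
  by (auto simp: clarke_cone_def elim!: eventually_mono)

lemma clarke_cone_if_clarke_deriv_less:
  assumes "clarke_deriv \<psi> z w < ereal r"
  shows "(w, r) \<in> clarke_cone \<psi> z"
proof -
  have "eventually (\<lambda>x. (case x of (u, t) \<Rightarrow> ereal ((\<psi> (u + t *\<^sub>R w) - \<psi> u) / t)) < ereal r)
      (nhds z \<times>\<^sub>F at_right 0)"
    using assms unfolding clarke_deriv_def by (rule Limsup_lessD)
  with snd_pos_prod_at_right[of z] show ?thesis
    unfolding clarke_cone_def mem_Collect_eq prod.case
    by eventually_elim (auto simp: pos_divide_less_eq)
qed

text \<open>Every direction occurs in the cone, which will exclude a vertical separating
  hyperplane.\<close>

lemma clarke_cone_direction_exists: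
  assumes "locally_lipschitz \<psi>"
  shows "\<exists>r. (w, r) \<in> clarke_cone \<psi> z"
proof -
  obtain U L where U: "open U" "z \<in> U" and L: "L-lipschitz_on U \<psi>"
    using assms unfolding locally_lipschitz_def by blast
  let ?F = "nhds z \<times>\<^sub>F at_right (0::real)"
  have U': "eventually (\<lambda>u. u \<in> U) (nhds z)"
    using U eventually_nhds by blast
  have 1: "eventually (\<lambda>x. fst x \<in> U) ?F"
    using eventually_compose_filterlim[OF U' filterlim_fst] .
  have 2: "eventually (\<lambda>(u, t). u + t *\<^sub>R w \<in> U) ?F"
    using eventually_compose_filterlim[OF 1 filterlim_shift_prod_at_right[of w z]]
    by (simp add: case_prod_unfold)
  \<comment> \<open>The Lipschitz bound gives slope \<open>L * norm w\<close>; the added 1 makes the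
    inequality strict, since \<open>t\<close> is positive.\<close>
  have "eventually (\<lambda>(u, t). \<psi> (u + t *\<^sub>R w) - \<psi> u < (L * norm w + 1) * t) ?F"
    using 1 2 snd_pos_prod_at_right[of z]
  proof eventually_elim
    case (elim x)
    obtain u t where x: "x = (u, t)" by (cases x)
    have "\<bar>\<psi> (u + t *\<^sub>R w) - \<psi> u\<bar> \<le> L * (t * norm w)"
      using lipschitz_onD[OF L, of "u + t *\<^sub>R w" u] elim x by (simp add: dist_norm)
    then show ?case using elim x by (simp add: algebra_simps)
  qed
  then show ?thesis unfolding clarke_cone_def by blast
qed

lemma clarke_gradient_nonempty:
  fixes \<psi> :: "real^'n \<Rightarrow> real"
  assumes "locally_lipschitz \<psi>"
  shows "clarke_gradient \<psi> z \<noteq> {}"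
proof -
  obtain c :: "(real^'n) \<times> real" where c: "c \<noteq> 0" "\<forall>x\<in>clarke_cone \<psi> z. 0 \<le> c \<bullet> x"
    using separating_hyperplane_set_0[OF convex_clarke_cone zero_notin_clarke_cone] by blast
  obtain a b where ab: "c = (a, b)" by (cases c)
  have sep: "0 \<le> a \<bullet> w + b * r" if "(w, r) \<in> clarke_cone \<psi> z" for w r
    using c(2) that ab by fastforce
  \<comment> \<open>The vertical vector (0, 1) lies in the cone.\<close>
  have "0 \<le> b"
    using sep[OF clarke_cone_zero_direction[of 1]] by simp
  moreover have "b \<noteq> 0"
  \<comment> \<open>If \<open>b = 0\<close>, then \<open>a\<close> is nonnegative on every
    direction, in particular on \<open>- a\<close>, so the whole normal \<open>c\<close>
    vanishes.\<close>
  proof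
    assume "b = 0"
    then have "0 \<le> a \<bullet> (- a)"
      using clarke_cone_direction_exists[OF assms, of "- a" z] sep[of "- a"] by auto
    then have "a = 0"
      by (metis inner_ge_zero inner_minus_right inner_eq_zero_iff neg_0_le_iff_le order_antisym)
    with \<open>b = 0\<close> ab c(1) show False by (simp add: zero_prod_def)
  qed
  ultimately have b: "0 < b" by simp
  \<comment> \<open>Dividing the separation inequality by \<open>b\<close> bounds \<open>r\<close>
    below by the pairing of \<open>-a/b\<close> with \<open>w\<close>, for every
    \<open>(w, r)\<close> in the cone. A real \<open>r\<close> strictly between the two sides of a
    failed inequality contradicts this, even if the derivative were minus infinity.\<close>
  have "ereal ((- (1 / b) *\<^sub>R a) \<bullet> w) \<le> clarke_deriv \<psi> z w" for w
  proof (rule ccontr)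
    assume "\<not> ereal ((- (1 / b) *\<^sub>R a) \<bullet> w) \<le> clarke_deriv \<psi> z w"
    then obtain r where r: "clarke_deriv \<psi> z w < ereal r" "r < (- (1 / b) *\<^sub>R a) \<bullet> w"
      using ereal_dense2 by (metis less_ereal.simps(1) not_le)
    have "0 \<le> a \<bullet> w + b * r"
      using sep clarke_cone_if_clarke_deriv_less[OF r(1)] by blast
    then show False using r(2) b by (simp add: field_simps)
  qed
  then show ?thesis unfolding clarke_gradient_def by blast
qed

text \<open>Adding \<open>[0, e]\<close> raises centre and half-width by \<open>e/2\<close> each, so
  the two strict inequalities sum to this one. As centre plus half-width is the upper endpoint, it
  compares upper endpoints.\<close>

lemma prec_CW_plus_Interval_imp:
  assumes "Q + Interval (0, e) \<prec>CW R" "0 \<le> e"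
  shows "icenter Q - icenter R + ihalfwidth Q - ihalfwidth R + e < 0"
proof -
  \<comment> \<open>Here \<open>0 \<le> e\<close> is essential: only then is \<open>(0, e)\<close> a
    valid pair of endpoints.\<close>
  have "bounds_of_interval (Interval (0, e)) = (0, e)"
    using assms(2) by (intro Interval_inverse) simp
  then have "lower (Interval (0, e)) = 0" "upper (Interval (0, e)) = e"
    by (simp_all add: lower.rep_eq upper.rep_eq)
  with assms(1) show ?thesis
    by (simp add: prec_CW_def icenter_def ihalfwidth_def field_simps)
qed

lemma mem_sum_scaled_setsE:
  fixes A :: "'i \<Rightarrow> 'a::real_vector set"
  assumes "x \<in> (\<Sum>i\<in>I. (\<lambda>y. c i *\<^sub>R y) ` A i)" "finite I"
  obtains y where "\<forall>i\<in>I. y i \<in> A i" "x = (\<Sum>i\<in>I. c i *\<^sub>R y i)"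
proof -
  obtain s where s: "x = sum s I" "\<forall>i\<in>I. s i \<in> (\<lambda>y. c i *\<^sub>R y) ` A i"
    using assms by (auto simp: set_sum_alt)
  then have "\<forall>i\<in>I. \<exists>y. y \<in> A i \<and> s i = c i *\<^sub>R y" by blast
  then obtain y where y: "\<forall>i\<in>I. y i \<in> A i \<and> s i = c i *\<^sub>R y i" by metis
  show thesis
    by (rule that[of y]) (use s y in auto)
qed

theorem theorem4p3:
  fixes m p :: nat
    and F :: "nat \<Rightarrow> real^'n \<Rightarrow> real interval"
    and g :: "nat \<Rightarrow> real^'n \<Rightarrow> real"
    and \<epsilon> :: "nat \<Rightarrow> real"
    and ubar :: "real^'n"
  assumes F_lip: "\<forall>k\<in>{1..m}. locally_lipschitz_interval (F k)"
    and g_lip: "\<forall>j\<in>{1..p}. locally_lipschitz (g j)"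
    and eps_nonneg: "\<forall>k\<in>{1..m}. 0 \<le> \<epsilon> k"
    and eps_nonzero: "\<exists>k\<in>{1..m}. \<epsilon> k \<noteq> 0"
    and ubar_feasible: "ubar \<in> feasible_set p g"
    and KKT: "\<exists>(lam :: nat \<Rightarrow> real) (\<mu> :: nat \<Rightarrow> real).
        (\<forall>k\<in>{1..m}. 0 \<le> lam k) \<and> (\<Sum>k\<in>{1..m}. lam k) = 1 \<and>
        (\<forall>j\<in>{1..p}. 0 \<le> \<mu> j) \<and>
        0 \<in> (\<Sum>k\<in>{1..m}. (\<lambda>x. lam k *\<^sub>R x) ` weak_gen_gradient (F k) ubar)
            + (\<Sum>j\<in>active_set p g ubar. (\<lambda>x. \<mu> j *\<^sub>R x) ` clarke_gradient (g j) ubar)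
            + (\<Sum>k\<in>{1..m}. (\<lambda>x. (lam k * \<epsilon> k) *\<^sub>R x) ` cball 0 1) \<and>
        (\<forall>j\<in>{1..p}. \<mu> j * g j ubar = 0)"
    and gen_convex: "generalized_convex_at m p F g (feasible_set p g) ubar"
  shows "ubar \<in> quasi_min m F (feasible_set p g) \<epsilon>"
proof (rule ccontr)
  let ?A = "active_set p g ubar"
  assume "ubar \<notin> quasi_min m F (feasible_set p g) \<epsilon>"
  then obtain z where z: "z \<in> feasible_set p g"
    and less: "\<forall>k\<in>{1..m}. F k z + Interval (0, \<epsilon> k * norm (z - ubar)) \<prec>CW F k ubar"
    using ubar_feasible unfolding quasi_min_def by blast
  \<comment> \<open>The bound that generalized convexity puts on the objective subgradients, equal
    to the change of the upper endpoint of \<open>F k\<close> from \<open>ubar\<close> to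
    \<open>z\<close>.\<close>
  define d where "d k = icenter (F k z) - icenter (F k ubar)
      + ihalfwidth (F k z) - ihalfwidth (F k ubar)" for k
  have neg: "d k + \<epsilon> k * norm (z - ubar) < 0" if "k \<in> {1..m}" for k
    unfolding d_def using prec_CW_plus_Interval_imp less eps_nonneg that by simp
  obtain lam \<mu> where lam: "\<forall>k\<in>{1..m}. 0 \<le> lam k" "(\<Sum>k\<in>{1..m}. lam k) = 1"
    and \<mu>: "\<forall>j\<in>{1..p}. 0 \<le> \<mu> j"
    and zero: "0 \<in> (\<Sum>k\<in>{1..m}. (\<lambda>x. lam k *\<^sub>R x) ` weak_gen_gradient (F k) ubar)
            + (\<Sum>j\<in>?A. (\<lambda>x. \<mu> j *\<^sub>R x) ` clarke_gradient (g j) ubar)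
            + (\<Sum>k\<in>{1..m}. (\<lambda>x. (lam k * \<epsilon> k) *\<^sub>R x) ` cball 0 1)"
    using KKT by blast
  have fin: "finite ?A" and A: "?A \<subseteq> {1..p}"
    by (auto simp: active_set_def)
  from zero obtain x1 x2 x3
    where x: "0 = x1 + x2 + x3"
      and x1: "x1 \<in> (\<Sum>k\<in>{1..m}. (\<lambda>x. lam k *\<^sub>R x) ` weak_gen_gradient (F k) ubar)"
      and x2: "x2 \<in> (\<Sum>j\<in>?A. (\<lambda>x. \<mu> j *\<^sub>R x) ` clarke_gradient (g j) ubar)"
      and x3: "x3 \<in> (\<Sum>k\<in>{1..m}. (\<lambda>x. (lam k * \<epsilon> k) *\<^sub>R x) ` cball 0 1)"
    by (elim set_plus_elim) blast
  obtain us where us: "\<forall>k\<in>{1..m}. us k \<in> weak_gen_gradient (F k) ubar"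
    and x1_eq: "x1 = (\<Sum>k\<in>{1..m}. lam k *\<^sub>R us k)"
    by (rule mem_sum_scaled_setsE[OF x1]) auto
  obtain zs where zs: "\<forall>j\<in>?A. zs j \<in> clarke_gradient (g j) ubar"
    and x2_eq: "x2 = (\<Sum>j\<in>?A. \<mu> j *\<^sub>R zs j)"
    by (rule mem_sum_scaled_setsE[OF x2 fin])
  obtain ys where ys: "\<forall>k\<in>{1..m}. ys k \<in> cball 0 1"
    and x3_eq: "x3 = (\<Sum>k\<in>{1..m}. (lam k * \<epsilon> k) *\<^sub>R ys k)"
    by (rule mem_sum_scaled_setsE[OF x3]) auto
  \<comment> \<open>The multiplier rule yields subgradients of active constraints only; nonemptiness
    of Clarke gradients completes the selection.\<close>
  define zs' where "zs' j = (if j \<in> ?A then zs j else SOME q. q \<in> clarke_gradient (g j) ubar)" for j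
  have zs': "\<forall>j\<in>{1..p}. zs' j \<in> clarke_gradient (g j) ubar"
    using zs g_lip clarke_gradient_nonempty by (auto simp: zs'_def some_in_eq)
  obtain v where v: "\<forall>k\<in>{1..m}. us k \<bullet> v \<le> d k" "\<forall>j\<in>{1..p}. zs' j \<bullet> v \<le> g j z - g j ubar"
      "\<forall>y\<in>cball 0 1. y \<bullet> v \<le> norm (z - ubar)"
    using gen_convex[unfolded generalized_convex_at_def, THEN conjunct2, rule_format,
        where us = us and zs = zs', OF z] us zs' unfolding d_def by blast
  have "x1 \<bullet> v \<le> (\<Sum>k\<in>{1..m}. lam k * d k)"
    unfolding x1_eq inner_sum_left using v(1) lam(1) by (auto intro!: sum_mono mult_left_mono)
  \<comment> \<open>An active constraint vanishes at \<open>ubar\<close> and is nonpositive at the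
    feasible point \<open>z\<close>, so its bound is at most 0.\<close>
  moreover have "x2 \<bullet> v \<le> 0"
    unfolding x2_eq inner_sum_left
  proof (rule sum_nonpos)
    fix j assume j: "j \<in> ?A"
    then have "zs' j \<bullet> v \<le> g j z - g j ubar"
      using v(2) A by blast
    moreover have "zs' j = zs j" using j by (simp add: zs'_def)
    moreover have "g j z \<le> 0" "g j ubar = 0" "0 \<le> \<mu> j"
      using j z \<mu> by (simp_all add: feasible_set_def active_set_def)
    ultimately have "zs j \<bullet> v \<le> 0" "0 \<le> \<mu> j"
      by simp_all
    then show "(\<mu> j *\<^sub>R zs j) \<bullet> v \<le> 0" by (simp add: mult_nonneg_nonpos)
  qed
  moreover have "x3 \<bullet> v \<le> (\<Sum>k\<in>{1..m}. lam k * (\<epsilon> k * norm (z - ubar)))"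
    unfolding x3_eq inner_sum_left
  proof (rule sum_mono)
    fix k assume k: "k \<in> {1..m}"
    then have "ys k \<bullet> v \<le> norm (z - ubar)" using ys v(3) by blast
    then show "((lam k * \<epsilon> k) *\<^sub>R ys k) \<bullet> v \<le> lam k * (\<epsilon> k * norm (z - ubar))"
      using lam(1) eps_nonneg k by (simp add: mult.assoc mult_left_mono)
  qed
  moreover have "x1 \<bullet> v + x2 \<bullet> v + x3 \<bullet> v = 0"
    using x by (metis inner_add_left inner_zero_left)
  ultimately have nonneg: "0 \<le> (\<Sum>k\<in>{1..m}. lam k * (d k + \<epsilon> k * norm (z - ubar)))"
    by (simp add: distrib_left sum.distrib)
  \<comment> \<open>Weights summing to 1 cannot all vanish; one positive weight makes the sum of
    nonpositive terms strictly negative.\<close>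
  obtain k where k: "k \<in> {1..m}" "lam k \<noteq> 0"
    using lam(2) by (metis sum.neutral zero_neq_one)
  then have "0 < lam k"
    using lam(1) by (simp add: less_le)
  have "(\<Sum>k\<in>{1..m}. lam k * (d k + \<epsilon> k * norm (z - ubar))) < (\<Sum>k\<in>{1..m}. 0)"
  proof (rule sum_strict_mono_ex1)
    show "\<forall>i\<in>{1..m}. lam i * (d i + \<epsilon> i * norm (z - ubar)) \<le> 0"
      using lam(1) neg by (blast intro: mult_nonneg_nonpos less_imp_le)
    show "\<exists>i\<in>{1..m}. lam i * (d i + \<epsilon> i * norm (z - ubar)) < 0"
      using mult_pos_neg[OF \<open>0 < lam k\<close> neg[OF k(1)]] k(1) by blast
  qed simp
  with nonneg show False by simp
qed

end
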